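(* For integers $n,k\geq 0$ and $s\geq 1$, \[ M_{k}^{(s)}(\underbrace{1,1,\ldots ,1}_{n \text{ times}})=\sum_{j=0}^{\lfloor k/(s+1)\rfloor }\binom{n}{k-j(s+1)}\binom{j+n-1}{n-1}. \]
   Context: $M_{k}^{(s)}(x_{1},\ldots,x_{n})=\sum x_{1}^{a_{1}}\cdots x_{n}^{a_{n}}$, the sum over all $n$-tuples of nonnegative integers $(a_1,\dots,a_n)$ with $a_1+\cdots+a_n=k$ and each $a_i\equiv 0$ or $1 \pmod{s+1}$; for $n=0$ it equals $\delta_{k,0}$. *)

theory Defs
  imports Complex_Main "HOL-Number_Theory.Cong"
begin

text \<open>
  \<open>M_poly s k xs\<close> is the polynomial \<open>M_k^(s)(x_1, \<dots>, x_n)\<close> as a polynomial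
  function: the argument list \<open>xs\<close> holds the values of \<open>x_1, \<dots>, x_n\<close> in an arbitrary commutative
  semiring, so \<open>n = length xs\<close>.
\<close>

definition M_exponents :: "nat \<Rightarrow> nat \<Rightarrow> nat \<Rightarrow> nat list set" where
  "M_exponents s k n =
     {as. length as = n \<and> sum_list as = k \<and>
          (\<forall>a\<in>set as. [a = 0] (mod (s + 1)) \<or> [a = 1] (mod (s + 1)))}"

definition M_poly :: "nat \<Rightarrow> nat \<Rightarrow> 'a::comm_semiring_1 list \<Rightarrow> 'a" where
  "M_poly s k xs =
     (\<Sum>as\<in>M_exponents s k (length xs). \<Prod>i<length xs. (xs ! i) ^ (as ! i))"

lemma M_poly_Nil: "M_poly s k [] = (if k = 0 then 1 else 0)"
proof -
  have "M_exponents s k 0 = (if k = 0 then {[]} else {})"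
    by (auto simp: M_exponents_def)
  then show ?thesis
    by (simp add: M_poly_def)
qed

text \<open>
  Binomial coefficients with arbitrary integer arguments. For a negative lower argument we use the
  convention that is symmetric under \<open>b \<mapsto> a - b\<close>; in particular \<open>ibinomial (-1) (-1) = 1\<close>, and
  \<open>ibinomial a (-1) = 0\<close> for \<open>a \<ge> 0\<close>. These are the values of \<open>binom(j + n - 1, n - 1)\<close> for \<open>n = 0\<close>
  that agree with \<open>binom(j + n - 1, j)\<close>. Natural-number subtraction would turn them into \<open>1\<close> for
  every \<open>j\<close>, and the convention \<open>binom(-1, -1) = 0\<close> would make the case \<open>n = k = 0\<close> fail.
  The values are integers; they live in \<open>rat\<close> because \<open>gchoose\<close> is set up for fields.
\<close>

definition ibinomial :: "int \<Rightarrow> int \<Rightarrow> rat" where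
  "ibinomial a b =
     (if 0 \<le> b then of_int a gchoose nat b
      else if 0 \<le> a - b then of_int a gchoose nat (a - b)
      else 0)"

lemma ibinomial_of_nat: "ibinomial (int m) (int r) = of_nat (m choose r)"
  by (simp add: ibinomial_def binomial_gbinomial)

lemma ibinomial_minus_one: "ibinomial (int j - 1) (- 1) = (if j = 0 then 1 else 0)"
proof (cases j)
  case (Suc i)
  have "ibinomial (int j - 1) (- 1) = of_nat i gchoose Suc i"
    by (simp add: ibinomial_def Suc nat_add_distrib)
  also have "\<dots> = 0"
    by (simp flip: binomial_gbinomial)
  finally show ?thesis
    by (simp add: Suc)
qed (simp add: ibinomial_def)

end

theory Submission
  imports Defs
begin

text \<open>
  For \<open>s \<ge> 1\<close>, division by \<open>s + 1\<close> writes an admissible exponent uniquely as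
  \<open>a = (s + 1) q + r\<close> with \<open>r \<in> {0, 1}\<close>. Hence an admissible \<open>n\<close>-tuple with sum \<open>k\<close> is the same as
  the set of indices with \<open>r = 1\<close> together with the \<open>n\<close>-tuple of quotients; if the quotients have
  sum \<open>j\<close>, then that set has \<open>k - j (s + 1)\<close> elements.
\<close>

lemma M_poly_replicate_one:
  "M_poly s k (replicate n (1::'a::comm_semiring_1)) = of_nat (card (M_exponents s k n))"
  by (simp add: M_poly_def)

text \<open>Passes to the form in which stars and bars counts tuples of length \<open>n\<close> with
  sum \<open>j\<close>. Truncated subtraction is harmless on the right: for \<open>n = 0\<close> it
  gives \<open>0 choose 0 = 1\<close> at \<open>j = 0\<close> and
  \<open>(j - 1) choose j = 0\<close> otherwise.\<close>

lemma ibinomial_weak_compositions: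
  "ibinomial (int j + int n - 1) (int n - 1) = of_nat ((j + n - 1) choose j)"
proof (cases n)
  case 0
  then show ?thesis
    using ibinomial_minus_one[of j] by (cases j) simp_all
next
  case (Suc m)
  have "(j + m) choose m = (j + m) choose j"
    using binomial_symmetric[of m "j + m"] by simp
  then show ?thesis
    using ibinomial_of_nat[of "j + m" m] by (simp add: Suc)
qed

definition compose_exponents :: "nat \<Rightarrow> nat \<Rightarrow> nat \<times> nat set \<times> nat list \<Rightarrow> nat list" where
  "compose_exponents s n = (\<lambda>(j, A, q). map (\<lambda>i. (s + 1) * q ! i + of_bool (i \<in> A)) [0..<n])"

text \<open>The sum of the quotients is recorded as a first component so that the image is a
  disjoint union indexed by the summation variable \<open>j\<close> of the theorem.\<close>

definition split_exponents :: "nat \<Rightarrow> nat \<Rightarrow> nat list \<Rightarrow> nat \<times> nat set \<times> nat list" where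
  "split_exponents s n as =
     (let q = map (\<lambda>a. a div (s + 1)) as in (sum_list q, {i. i < n \<and> as ! i mod (s + 1) = 1}, q))"

text \<open>Summing the remainders over all positions counts \<open>A\<close>. Both directions of
  the bijection use this to relate the total to the quotients.\<close>

lemma sum_list_split:
  fixes as :: "nat list"
  assumes "\<And>i. i < n \<Longrightarrow> as ! i = m * q ! i + of_bool (i \<in> A)"
    and "length as = n" "length q = n" "A \<subseteq> {..<n}"
  shows "sum_list as = m * sum_list q + card A"
proof -
  have "{..<n} \<inter> A = A"
    using assms(4) by blast
  have "sum_list as = (\<Sum>i<n. m * q ! i + of_bool (i \<in> A))"
    using assms(1,2) by (simp add: sum_list_sum_nth atLeast0LessThan)
  also have "\<dots> = m * sum_list q + card A"
    using assms(3) \<open>{..<n} \<inter> A = A\<close>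
    by (simp add: sum.distrib sum_list_sum_nth atLeast0LessThan flip: sum_distrib_left)
  finally show ?thesis .
qed

lemma bij_betw_split_exponents:
  assumes "s \<ge> 1"
  shows "bij_betw (split_exponents s n) (M_exponents s k n)
    (SIGMA j : {0..k div (s + 1)}.
       {A. A \<subseteq> {..<n} \<and> card A = k - j * (s + 1)} \<times> {q. length q = n \<and> sum_list q = j})"
    (is "bij_betw _ _ ?S")
proof (rule bij_betw_byWitness[where f' = "compose_exponents s n"])
  \<comment> \<open>Here \<open>s \<ge> 1\<close> enters: the modulus is at least 2, so the residues
    0 and 1 are distinct.\<close>
  have one: "1 mod (s + 1) = 1"
    using assms by simp
  have digits: "as ! i = (s + 1) * (as ! i div (s + 1)) + of_bool (as ! i mod (s + 1) = 1)"
    if "as \<in> M_exponents s k n" "i < n" for as i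
  proof -
    have "as ! i mod (s + 1) = 0 \<or> as ! i mod (s + 1) = 1"
      using that one nth_mem[of i as] by (auto simp: M_exponents_def cong_def simp del: nth_mem)
    then show ?thesis
      using mult_div_mod_eq[of "s + 1" "as ! i"] by (auto simp del: mult_div_mod_eq)
  qed
  show "\<forall>as\<in>M_exponents s k n. compose_exponents s n (split_exponents s n as) = as"
  proof
    fix as assume as: "as \<in> M_exponents s k n"
    then have "length as = n"
      by (simp add: M_exponents_def)
    then show "compose_exponents s n (split_exponents s n as) = as"
      using digits[OF as]
      by (intro nth_equalityI) (simp_all add: compose_exponents_def split_exponents_def Let_def)
  qed
  show "split_exponents s n ` M_exponents s k n \<subseteq> ?S"
  proof (rule image_subsetI)
    fix as assume as: "as \<in> M_exponents s k n"
    let ?A = "{i. i < n \<and> as ! i mod (s + 1) = 1}" and ?q = "map (\<lambda>a. a div (s + 1)) as"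
    have len: "length as = n" "sum_list as = k"
      using as by (auto simp: M_exponents_def)
    \<comment> \<open>This additive identity yields both the bound on \<open>j\<close> and the size
      of the index set.\<close>
    have eq: "k = (s + 1) * sum_list ?q + card ?A"
      unfolding len(2)[symmetric]
      by (rule sum_list_split[where n = n]) (use digits[OF as] len in auto)
    then have "sum_list ?q * (s + 1) \<le> k"
      by (simp add: mult.commute)
    then have "sum_list ?q \<le> k div (s + 1)"
      by (simp add: less_eq_div_iff_mult_less_eq)
    moreover have "card ?A = k - sum_list ?q * (s + 1)"
      using eq by (simp add: mult.commute)
    ultimately show "split_exponents s n as \<in> ?S"
      using len by (auto simp: split_exponents_def Let_def)
  qed
  \<comment> \<open>A digit 0 or 1 is a genuine remainder, so \<open>div\<close> and
    \<open>mod\<close> recover \<open>q\<close> and \<open>A\<close>.\<close>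
  have lt: "of_bool P < s + 1" for P
    using assms by (cases P) simp_all
  have quot: "((s + 1) * c + of_bool P) div (s + 1) = c" for c P
    using div_mult_self4[of "s + 1" c "of_bool P"] div_less[OF lt] by simp
  have rem: "((s + 1) * c + of_bool P) mod (s + 1) = of_bool P" for c P
    unfolding mod_mult_self4 by (rule mod_less[OF lt])
  show "\<forall>x\<in>?S. split_exponents s n (compose_exponents s n x) = x"
  proof
    fix x assume "x \<in> ?S"
    then obtain j A q where x: "x = (j, A, q)" "A \<subseteq> {..<n}" "length q = n" "sum_list q = j"
      by auto
    have "map (\<lambda>a. a div (s + 1)) (compose_exponents s n x) = q"
      using x by (intro nth_equalityI) (simp_all add: compose_exponents_def quot del: add_Suc_right One_nat_def)
    moreover have "compose_exponents s n x ! i mod (s + 1) = of_bool (i \<in> A)" if "i < n" for i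
      using x that rem[of "q ! i" "i \<in> A"] by (simp add: compose_exponents_def)
    then have "{i. i < n \<and> compose_exponents s n x ! i mod (s + 1) = 1} = {i. i < n \<and> i \<in> A}"
      by (intro Collect_cong conj_cong refl) (simp only: of_bool_eq_1_iff)
    then have "{i. i < n \<and> compose_exponents s n x ! i mod (s + 1) = 1} = A"
      using x(2) by blast
    ultimately show "split_exponents s n (compose_exponents s n x) = x"
      using x(1,4) unfolding split_exponents_def Let_def by simp
  qed
  show "compose_exponents s n ` ?S \<subseteq> M_exponents s k n"
  proof (rule image_subsetI)
    fix x assume "x \<in> ?S"
    obtain j A q where x: "x = (j, A, q)"
      by (cases x)
    have j: "j \<le> k div (s + 1)" and A: "A \<subseteq> {..<n}" "card A = k - j * (s + 1)"
      and q: "length q = n" "sum_list q = j"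
      using \<open>x \<in> ?S\<close> unfolding x
      by (simp_all only: mem_Sigma_iff mem_Collect_eq atLeastAtMost_iff)
    have "sum_list (compose_exponents s n x) = (s + 1) * sum_list q + card A"
      by (rule sum_list_split[where n = n]) (use x A(1) q(1) in \<open>simp_all add: compose_exponents_def\<close>)
    \<comment> \<open>Hence the subtraction in \<open>card A = k - j * (s + 1)\<close> is not
      truncated, and adding \<open>j * (s + 1)\<close> back gives exactly \<open>k\<close>.\<close>
    moreover have "j * (s + 1) \<le> k"
      using j by (simp add: less_eq_div_iff_mult_less_eq)
    ultimately have "sum_list (compose_exponents s n x) = k"
      unfolding A(2) q(2) mult.commute[of "s + 1"] by simp
    moreover have "[(s + 1) * c + of_bool P = 0] (mod (s + 1)) \<or> [(s + 1) * c + of_bool P = 1] (mod (s + 1))"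
      for c P
      unfolding cong_def rem one by (cases P) simp_all
    then have "\<forall>a\<in>set (compose_exponents s n x). [a = 0] (mod (s + 1)) \<or> [a = 1] (mod (s + 1))"
      unfolding x compose_exponents_def by (simp only: prod.case set_map ball_simps) blast
    moreover have "length (compose_exponents s n x) = n"
      by (simp add: x compose_exponents_def)
    ultimately show "compose_exponents s n x \<in> M_exponents s k n"
      unfolding M_exponents_def by blast
  qed
qed

theorem theorem3p3:
  fixes n k s :: nat
  assumes "s \<ge> 1"
  shows "M_poly s k (replicate n (1::rat)) =
    (\<Sum>j = 0..k div (s + 1).
       of_nat (n choose (k - j * (s + 1))) * ibinomial (int j + int n - 1) (int n - 1))"
proof -
  \<comment> \<open>Each entry is at most the sum \<open>j\<close>; finiteness of the fibres allows
    counting the \<open>SIGMA\<close> set fibre by fibre.\<close>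
  have fin: "finite {q :: nat list. length q = n \<and> sum_list q = j}" for j
  proof (rule finite_subset)
    show "{q :: nat list. length q = n \<and> sum_list q = j} \<subseteq> {q. set q \<subseteq> {..j} \<and> length q = n}"
      using member_le_sum_list by fastforce
  qed (simp add: finite_lists_length_eq)
  have "card (M_exponents s k n) =
    (\<Sum>j = 0..k div (s + 1). (n choose (k - j * (s + 1))) * ((j + n - 1) choose j))"
    \<comment> \<open>In each fibre, \<open>n_subsets\<close> counts the choices of \<open>A\<close>
      and \<open>card_length_sum_list\<close> (stars and bars) those of \<open>q\<close>.\<close>
    unfolding bij_betw_same_card[OF bij_betw_split_exponents[OF assms]]
    by (subst card_SigmaI)
       (auto simp: fin card_cartesian_product n_subsets card_length_sum_list)
  then show ?thesis
    by (simp add: M_poly_replicate_one ibinomial_weak_compositions)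
qed

end
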